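(* Let $0<\beta<2$, let $r>2$ and $s\geq r+1$. Then the singular incompressible porous media (SIPM) equation on $\mathbb{T}^2\times[0,\infty)$, $$\partial_t\rho+\boldsymbol{v}\cdot\nabla\rho=0,\qquad \boldsymbol{v}=-\nabla(-\Delta)^{-1}\partial_{x_2}\Lambda^\beta\rho-(0,\Lambda^\beta\rho),$$ is locally Lipschitz $(H^r,H^s)$ ill-posed, i.e. it is not locally Lipschitz $(H^r,H^s)$ well-posed in the sense defined in the context.
   Context: Here $\Lambda=(-\Delta)^{1/2}$ is the Zygmund operator; equivalently $\boldsymbol{v}=\boldsymbol{R}^\perp R_1\Lambda^\beta\rho$, the Fourier multiplier with symbol $-k_1\boldsymbol{k}^\perp|\boldsymbol{k}|^{\beta-2}$ (with $\boldsymbol{k}^\perp=(-k_2,k_1)$), where $\boldsymbol{R}=(R_1,R_2)$ are the Riesz transforms. Definition: let $Y\subset X\subset L^2$ be Banach spaces. The initial value problem for the SIPM equation is called locally Lipschitz $(X,Y)$ well-posed if there exist continuous functions $T:[0,\infty)^2\to(0,\infty)$, non-increasing in both variables, and $K:[0,\infty)^2\to(0,\infty)$, non-decreasing in both variables, such that for every pair of initial data $\rho^{(1)}_0,\rho^{(2)}_0\in Y$ there exist unique solutions $\rho^{(1)},\rho^{(2)}\in L^\infty(0,T;X)$ of the SIPM initial value problem with these data, satisfying $\|\rho^{(1)}(\cdot,t)-\rho^{(2)}(\cdot,t)\|_X\leq K\|\rho^{(1)}_0-\rho^{(2)}_0\|_Y$ for every $t\in[0,T]$, where $T=T(\|\rho^{(1)}_0\|_Y,\|\rho^{(2)}_0\|_Y)$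 and $K=K(\|\rho^{(1)}_0\|_Y,\|\rho^{(2)}_0\|_Y)$. *)

theory Defs
  imports "HOL-Analysis.Analysis"
begin

text \<open>Functions on the torus T^2 = (R/2 pi Z)^2 are represented by their Fourier
coefficients c :: int \<times> int \<Rightarrow> complex, f(x) = sum_k c(k) e^{i k.x}.\<close>

definition knorm :: "int \<times> int \<Rightarrow> real" where
  "knorm k = sqrt (real_of_int (fst k) ^ 2 + real_of_int (snd k) ^ 2)"

definition sob_weight :: "real \<Rightarrow> (int \<times> int \<Rightarrow> complex) \<Rightarrow> int \<times> int \<Rightarrow> real" where
  "sob_weight r c k = (1 + (knorm k)^2) powr r * (cmod (c k))^2"

definition hnorm :: "real \<Rightarrow> (int \<times> int \<Rightarrow> complex) \<Rightarrow> real" where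
  "hnorm r c = sqrt (\<Sum>\<^sub>\<infinity>k. sob_weight r c k)"

definition real_valued :: "(int \<times> int \<Rightarrow> complex) \<Rightarrow> bool" where
  "real_valued c \<longleftrightarrow> (\<forall>k. c (- fst k, - snd k) = cnj (c k))"

definition Hs :: "real \<Rightarrow> (int \<times> int \<Rightarrow> complex) set" where
  "Hs r = {c. real_valued c \<and> (sob_weight r c) summable_on UNIV}"

text \<open>Symbol of the SIPM velocity: v^(k) = - k1 k^perp |k|^(beta-2) rho^(k), k^perp = (-k2,k1).\<close>
definition vsym :: "real \<Rightarrow> int \<times> int \<Rightarrow> real \<times> real" where
  "vsym \<beta> k = (let k1 = real_of_int (fst k); k2 = real_of_int (snd k); m = knorm k powr (\<beta> - 2)
               in (- k1 * (- k2) * m, - k1 * k1 * m))"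

definition nonlin :: "real \<Rightarrow> (int \<times> int \<Rightarrow> complex) \<Rightarrow> int \<times> int \<Rightarrow> complex" where
  "nonlin \<beta> c k = (\<Sum>\<^sub>\<infinity>j. \<i> * complex_of_real
       (fst (vsym \<beta> j) * real_of_int (fst k - fst j) + snd (vsym \<beta> j) * real_of_int (snd k - snd j))
       * c j * c (fst k - fst j, snd k - snd j))"

text \<open>rho is a solution in L^infty(0,T;H^r) of the SIPM initial value problem with datum c0:
  the equation d_t rho + v.grad rho = 0 holds in integrated form for every Fourier mode.\<close>
definition sipm_solution :: "real \<Rightarrow> real \<Rightarrow> real \<Rightarrow> (int \<times> int \<Rightarrow> complex)
      \<Rightarrow> (real \<Rightarrow> int \<times> int \<Rightarrow> complex) \<Rightarrow> bool" where
  "sipm_solution \<beta> r T c0 \<rho> \<longleftrightarrow>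
     \<rho> 0 = c0 \<and>
     (\<forall>t\<in>{0..T}. \<rho> t \<in> Hs r) \<and>
     (\<exists>M. \<forall>t\<in>{0..T}. hnorm r (\<rho> t) \<le> M) \<and>
     (\<forall>k. \<forall>t\<in>{0..T}. ((\<lambda>\<tau>. nonlin \<beta> (\<rho> \<tau>) k) has_integral (c0 k - \<rho> t k)) {0..t})"

definition locally_lipschitz_wellposed :: "real \<Rightarrow> real \<Rightarrow> real \<Rightarrow> bool" where
  "locally_lipschitz_wellposed \<beta> r s \<longleftrightarrow>
    (\<exists>T K :: real \<Rightarrow> real \<Rightarrow> real.
       continuous_on ({0..} \<times> {0..}) (\<lambda>(a, b). T a b) \<and>
       (\<forall>a\<ge>0. \<forall>b\<ge>0. T a b > 0) \<and>
       (\<forall>a a' b b'. 0 \<le> a \<longrightarrow> a \<le> a' \<longrightarrow> 0 \<le> b \<longrightarrow> b \<le> b' \<longrightarrow> T a' b' \<le> T a b) \<and>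
       continuous_on ({0..} \<times> {0..}) (\<lambda>(a, b). K a b) \<and>
       (\<forall>a\<ge>0. \<forall>b\<ge>0. K a b > 0) \<and>
       (\<forall>a a' b b'. 0 \<le> a \<longrightarrow> a \<le> a' \<longrightarrow> 0 \<le> b \<longrightarrow> b \<le> b' \<longrightarrow> K a b \<le> K a' b') \<and>
       (\<forall>c1\<in>Hs s. \<forall>c2\<in>Hs s.
          (let T0 = T (hnorm s c1) (hnorm s c2); K0 = K (hnorm s c1) (hnorm s c2) in
           \<exists>\<rho>1 \<rho>2.
             sipm_solution \<beta> r T0 c1 \<rho>1 \<and> sipm_solution \<beta> r T0 c2 \<rho>2 \<and>
             (\<forall>\<sigma>. sipm_solution \<beta> r T0 c1 \<sigma> \<longrightarrow> (\<forall>t\<in>{0..T0}. \<sigma> t = \<rho>1 t)) \<and>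
             (\<forall>\<sigma>. sipm_solution \<beta> r T0 c2 \<sigma> \<longrightarrow> (\<forall>t\<in>{0..T0}. \<sigma> t = \<rho>2 t)) \<and>
             (\<forall>t\<in>{0..T0}. hnorm r (\<lambda>k. \<rho>1 t k - \<rho>2 t k) \<le> K0 * hnorm s (\<lambda>k. c1 k - c2 k)))))"

end

theory Submission
  imports Defs "HOL-Real_Asymp.Real_Asymp"
begin

text \<open>Functions of $x_2$ alone are steady states, because the velocity symbol vanishes at
  $k_1 = 0$. Linearising at $2 \sin x_2$ and keeping the modes $(n, k)$ with $n$ fixed gives
  $f_k' = a_{k-1} f_{k-1} + a_{k+1} f_{k+1}$ with $a_k = n^2 |(n,k)|^{\beta-2} > 0$. This system
  is bounded for fixed $n$, but since $a_0$ and $a_1$ are of order $n^\beta$ and all coefficients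
  are positive, $f_0 + f_1$ grows at least like $\exp(n^\beta t / 4)$. Lipschitz dependence on the
  data makes the quadratic remainder of a perturbation of size $\epsilon$ equal to
  $O(\epsilon^2)$, so it would bound this growth by a power of $n$.\<close>

section \<open>Infinite tridiagonal systems\<close>

text \<open>The coefficient belongs to the source mode, not to the target: it stems from the
  velocity symbol, which is evaluated at the advecting mode.\<close>

definition hop :: "(int \<Rightarrow> real) \<Rightarrow> (int \<Rightarrow> complex) \<Rightarrow> int \<Rightarrow> complex" where
  "hop a g k = of_real (a (k - 1)) * g (k - 1) + of_real (a (k + 1)) * g (k + 1)"

text \<open>Picard iteration of a forcing bounded by \<open>c\<close>, each time integral being
  estimated crudely by the factor \<open>T\<close>. The error is kept mode by mode because the
  \<open>c\<close> needed below grows linearly in \<open>k\<close>; for fixed \<open>J\<close> each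
  value is still a finite number.\<close>

fun taylor_err :: "real \<Rightarrow> real \<Rightarrow> (int \<Rightarrow> real) \<Rightarrow> nat \<Rightarrow> int \<Rightarrow> real" where
  "taylor_err T A c 0 k = 0"
| "taylor_err T A c (Suc J) k = T * (c k + A * (taylor_err T A c J (k - 1) + taylor_err T A c J (k + 1)))"

lemma taylor_err_nonneg:
  assumes "0 \<le> T" "0 \<le> A" "\<And>k. 0 \<le> c k"
  shows "0 \<le> taylor_err T A c J k"
  using assms by (induction J arbitrary: k) (auto intro!: mult_nonneg_nonneg add_nonneg_nonneg)

lemma has_integral_power_atLeastAtMost:
  fixes t :: real
  assumes "0 \<le> t"
  shows "((\<lambda>x. x ^ j / fact j) has_integral t ^ Suc j / fact (Suc j)) {0..t}"
proof -
  have "((\<lambda>x. x ^ j / fact j) has_integral t ^ Suc j / fact (Suc j) - 0 ^ Suc j / fact (Suc j)) {0..t}"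
  proof (rule fundamental_theorem_of_calculus)
    fix x :: real
    have "((\<lambda>x. x ^ Suc j / fact (Suc j)) has_real_derivative (real (Suc j) * x ^ j / fact (Suc j))) (at x within {0..t})"
      by (auto intro!: derivative_eq_intros simp del: fact_Suc power_Suc)
    moreover have "real (Suc j) * x ^ j / fact (Suc j) = x ^ j / fact j"
      by (simp del: of_nat_Suc)
    ultimately show "((\<lambda>x. x ^ Suc j / fact (Suc j)) has_vector_derivative x ^ j / fact j) (at x within {0..t})"
      by (simp add: has_real_derivative_iff_has_vector_derivative)
  qed (use assms in auto)
  then show ?thesis by simp
qed

text \<open>Induction on \<open>J\<close>: the bound for the current remainder is inserted into the
  integral equation. A further integration turns the crude bound \<open>M\<close> into a term of the
  exponential series of \<open>2 * A * t\<close>, the 2 coming from the two neighbours, while the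
  forcing is collected in \<open>taylor_err\<close>.\<close>

lemma tridiagonal_taylor_bound:
  fixes f :: "real \<Rightarrow> int \<Rightarrow> complex"
  assumes a: "\<And>k. 0 \<le> a k" "\<And>k. a k \<le> A"
    and c: "\<And>k. 0 \<le> c k" and "0 \<le> \<delta>" "0 \<le> M"
    and f: "\<And>k t. t \<in> {0..T} \<Longrightarrow> cmod (f t k) \<le> M"
    and eq: "\<And>k t. t \<in> {0..T} \<Longrightarrow>
      ((\<lambda>\<tau>. hop a (f \<tau>) k + q \<tau> k) has_integral (f t k - f 0 k)) {0..t}"
    and q: "\<And>k t. t \<in> {0..T} \<Longrightarrow> cmod (q t k) \<le> \<delta> * c k"
    and t: "t \<in> {0..T}"
  shows "cmod (f t k - (\<Sum>j<J. of_real (t ^ j / fact j) * (hop a ^^ j) (f 0) k))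
    \<le> \<delta> * taylor_err T A c J k + M * (2 * A) ^ J * (t ^ J / fact J)"
  using t
proof (induction J arbitrary: k t)
  case 0
  then show ?case using f by simp
next
  case (Suc J)
  define B where "B = (\<lambda>j k. (hop a ^^ j) (f 0) k)"
  define g where "g = (\<lambda>\<tau> k. f \<tau> k - (\<Sum>j<J. of_real (\<tau> ^ j / fact j) * B j k))"
  define e where "e = \<delta> * (c k + A * (taylor_err T A c J (k - 1) + taylor_err T A c J (k + 1)))"
  have A: "0 \<le> A" using a[of 0] by linarith
  have T: "0 \<le> T" and t0: "0 \<le> t" using Suc.prems by auto
  have IH: "cmod (g \<tau> k') \<le> \<delta> * taylor_err T A c J k' + M * (2 * A) ^ J * (\<tau> ^ J / fact J)"
    if "\<tau> \<in> {0..T}" for \<tau> k'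
    using Suc.IH[OF that] unfolding g_def B_def .
  \<comment> \<open>Applying \<open>hop\<close> to the Taylor polynomial only raises the index of
    \<open>B\<close>, so the remainder \<open>g\<close> obeys the same system with a polynomial
    source that integrates explicitly.\<close>
  have hop_sum: "hop a (f \<tau>) k = hop a (g \<tau>) k + (\<Sum>j<J. of_real (\<tau> ^ j / fact j) * B (Suc j) k)" for \<tau>
    by (simp add: g_def B_def hop_def algebra_simps sum.distrib sum_distrib_left)
  have "((\<lambda>\<tau>. of_real (\<tau> ^ j / fact j) * B (Suc j) k) has_integral
      of_real (t ^ Suc j / fact (Suc j)) * B (Suc j) k) {0..t}" for j
    by (intro has_integral_mult_left has_integral_of_real has_integral_power_atLeastAtMost t0)
  then have "((\<lambda>\<tau>. \<Sum>j<J. of_real (\<tau> ^ j / fact j) * B (Suc j) k) has_integral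
      (\<Sum>j<J. of_real (t ^ Suc j / fact (Suc j)) * B (Suc j) k)) {0..t}"
    by (intro has_integral_sum) auto
  from has_integral_diff[OF eq[OF Suc.prems, of k] this]
  have int1: "((\<lambda>\<tau>. hop a (g \<tau>) k + q \<tau> k) has_integral
      (f t k - f 0 k - (\<Sum>j<J. of_real (t ^ Suc j / fact (Suc j)) * B (Suc j) k))) {0..t}"
    by (simp add: hop_sum algebra_simps)
  \<comment> \<open>The datum \<open>f 0 k\<close> is the missing \<open>j = 0\<close> term, so
    integration yields the Taylor polynomial with one more term.\<close>
  have "f t k - f 0 k - (\<Sum>j<J. of_real (t ^ Suc j / fact (Suc j)) * B (Suc j) k)
      = f t k - (\<Sum>j<Suc J. of_real (t ^ j / fact j) * B j k)"
    by (subst sum.lessThan_Suc_shift) (simp add: B_def del: funpow.simps(2) fact_Suc power_Suc)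
  with int1 have int1: "((\<lambda>\<tau>. hop a (g \<tau>) k + q \<tau> k) has_integral
      (f t k - (\<Sum>j<Suc J. of_real (t ^ j / fact j) * B j k))) {0..t}" by (simp only:)
  have int2: "((\<lambda>\<tau>. e + M * (2 * A) ^ Suc J * (\<tau> ^ J / fact J)) has_integral
      (t * e + M * (2 * A) ^ Suc J * (t ^ Suc J / fact (Suc J)))) {0..t}"
    using has_integral_const_real[of e 0 t] t0
    by (intro has_integral_add has_integral_mult_right has_integral_power_atLeastAtMost) auto
  have bound: "cmod (hop a (g \<tau>) k + q \<tau> k) \<le> e + M * (2 * A) ^ Suc J * (\<tau> ^ J / fact J)"
    if "\<tau> \<in> {0..t}" for \<tau>
  proof -
    have \<tau>: "\<tau> \<in> {0..T}" using that Suc.prems by auto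
    have *: "cmod (of_real (a k') * g \<tau> k') \<le> A * (\<delta> * taylor_err T A c J k' + M * (2 * A) ^ J * (\<tau> ^ J / fact J))" for k'
      unfolding norm_mult using a[of k'] A by (intro mult_mono IH \<tau>) auto
    have "cmod (hop a (g \<tau>) k + q \<tau> k) \<le> cmod (of_real (a (k - 1)) * g \<tau> (k - 1))
        + cmod (of_real (a (k + 1)) * g \<tau> (k + 1)) + cmod (q \<tau> k)"
      unfolding hop_def by (intro order_trans[OF norm_triangle_ineq] add_mono order_refl norm_triangle_ineq)
    also have "\<dots> \<le> A * (\<delta> * taylor_err T A c J (k - 1) + M * (2 * A) ^ J * (\<tau> ^ J / fact J))
       + A * (\<delta> * taylor_err T A c J (k + 1) + M * (2 * A) ^ J * (\<tau> ^ J / fact J)) + \<delta> * c k"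
      by (intro add_mono * q \<tau>)
    also have "\<dots> = e + M * (2 * A) ^ Suc J * (\<tau> ^ J / fact J)"
      by (simp add: e_def algebra_simps)
    finally show ?thesis .
  qed
  have "cmod (f t k - (\<Sum>j<Suc J. of_real (t ^ j / fact j) * B j k))
      \<le> t * e + M * (2 * A) ^ Suc J * (t ^ Suc J / fact (Suc J))"
    using integral_norm_bound_integral[OF has_integral_integrable[OF int1] has_integral_integrable[OF int2] bound]
    unfolding integral_unique[OF int1] integral_unique[OF int2] .
  also have "t * e \<le> T * e"
    using Suc.prems taylor_err_nonneg[OF T A, of c J] c A \<open>0 \<le> \<delta>\<close>
    by (intro mult_right_mono) (auto simp: e_def)
  also have "T * e = \<delta> * taylor_err T A c (Suc J) k"
    by (simp add: e_def)
  finally show ?case by (simp add: B_def)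
qed

lemma hop_funpow_scale:
  "(hop a ^^ j) (\<lambda>k. of_real (\<epsilon> * g k)) k = of_real \<epsilon> * (hop a ^^ j) (\<lambda>k. of_real (g k)) k"
  by (induction j arbitrary: k) (simp_all add: hop_def algebra_simps)

text \<open>All entries stay nonnegative, so every exchange except the one between modes 0 and 1 may
  be dropped. Only \<open>a 0\<close> and \<open>a 1\<close> need a lower bound; the other
  coefficients may be arbitrarily small.\<close>

lemma hop_funpow_lower_bound:
  assumes a: "\<And>k. 0 \<le> a k" and "0 \<le> \<mu>" "\<mu> \<le> a 0" "\<mu> \<le> a 1"
    and g: "\<And>k. 0 \<le> g k" "1 \<le> g 0 + g 1"
  shows "\<mu> ^ j \<le> Re ((hop a ^^ j) (\<lambda>k. of_real (g k)) 0 + (hop a ^^ j) (\<lambda>k. of_real (g k)) 1)"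
proof -
  define h where "h = (\<lambda>j k. Re ((hop a ^^ j) (\<lambda>k. of_real (g k)) k))"
  have hSuc: "h (Suc j) k = a (k - 1) * h j (k - 1) + a (k + 1) * h j (k + 1)" for j k
    by (simp add: h_def hop_def)
  have pos: "0 \<le> h j k" for j k
  proof (induction j arbitrary: k)
    case 0 then show ?case by (simp add: h_def g)
  next
    case (Suc j) then show ?case by (simp add: hSuc a)
  qed
  have "\<mu> ^ j \<le> h j 0 + h j 1"
  proof (induction j)
    case 0 then show ?case by (simp add: h_def g)
  next
    case (Suc j)
    have "\<mu> ^ Suc j \<le> \<mu> * h j 0 + \<mu> * h j 1"
      using mult_left_mono[OF Suc \<open>0 \<le> \<mu>\<close>] by (simp add: algebra_simps)
    also have "\<dots> \<le> a 0 * h j 0 + a 1 * h j 1"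
      using assms pos by (intro add_mono mult_right_mono) auto
    also have "\<dots> \<le> h (Suc j) 0 + h (Suc j) 1"
      using a pos by (simp add: hSuc)
    finally show ?case .
  qed
  then show ?thesis by (simp add: h_def)
qed

section \<open>Sobolev norms\<close>

lemma powr_half_square: "((x :: real) powr (s / 2))\<^sup>2 = x powr s"
  by (simp add: power2_eq_square flip: powr_add)

lemma sob_weight_nonneg: "0 \<le> sob_weight r c k"
  by (simp add: sob_weight_def)

lemma hnorm_nonneg: "0 \<le> hnorm r c"
  by (simp add: hnorm_def infsum_nonneg sob_weight_nonneg)

lemma hnorm_square: "(hnorm r c)\<^sup>2 = (\<Sum>\<^sub>\<infinity>k. sob_weight r c k)"
  by (simp add: hnorm_def infsum_nonneg sob_weight_nonneg)

lemma hnorm_minus_commute: "hnorm r (\<lambda>k. b k - c k) = hnorm r (\<lambda>k. c k - b k)"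
  by (simp add: hnorm_def sob_weight_def norm_minus_commute)

lemma sob_weight_ge:
  assumes "0 \<le> r"
  shows "(cmod (c k))\<^sup>2 \<le> sob_weight r c k"
  using ge_one_powr_ge_zero[of "1 + (knorm k)\<^sup>2" r] assms
    mult_right_mono[of 1 "(1 + (knorm k)\<^sup>2) powr r" "(cmod (c k))\<^sup>2"]
  by (simp add: sob_weight_def)

lemma cmod_le_hnorm:
  assumes "0 \<le> r" "c \<in> Hs r"
  shows "cmod (c k) \<le> hnorm r c"
proof (rule power2_le_imp_le[OF _ hnorm_nonneg])
  have "(cmod (c k))\<^sup>2 \<le> sob_weight r c k"
    by (rule sob_weight_ge[OF assms(1)])
  also have "\<dots> = (\<Sum>\<^sub>\<infinity>j\<in>{k}. sob_weight r c j)" by simp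
  also have "\<dots> \<le> (\<Sum>\<^sub>\<infinity>j. sob_weight r c j)"
    using assms by (intro infsum_mono_neutral) (auto simp: Hs_def sob_weight_nonneg)
  finally show "(cmod (c k))\<^sup>2 \<le> (hnorm r c)\<^sup>2" by (simp add: hnorm_square)
qed

lemma Hs_diff:
  assumes "b \<in> Hs r" "c \<in> Hs r"
  shows "(\<lambda>k. b k - c k) \<in> Hs r"
proof -
  have bound: "sob_weight r (\<lambda>k. b k - c k) k \<le> 2 * sob_weight r b k + 2 * sob_weight r c k" for k
  proof -
    have "(cmod (b k - c k))\<^sup>2 \<le> (cmod (b k) + cmod (c k))\<^sup>2"
      by (intro power_mono norm_triangle_ineq4) auto
    also have "\<dots> \<le> 2 * (cmod (b k))\<^sup>2 + 2 * (cmod (c k))\<^sup>2"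
      using sum_squares_bound[of "cmod (b k)" "cmod (c k)"] by (simp add: power2_sum)
    finally have "(1 + (knorm k)\<^sup>2) powr r * (cmod (b k - c k))\<^sup>2
      \<le> (1 + (knorm k)\<^sup>2) powr r * (2 * (cmod (b k))\<^sup>2 + 2 * (cmod (c k))\<^sup>2)"
      by (intro mult_left_mono) auto
    then show ?thesis by (simp add: sob_weight_def algebra_simps)
  qed
  have sum: "(\<lambda>k. 2 * sob_weight r b k + 2 * sob_weight r c k) summable_on UNIV"
    using assms by (intro summable_on_add summable_on_cmult_right) (auto simp: Hs_def)
  have "sob_weight r (\<lambda>k. b k - c k) summable_on UNIV"
    by (rule summable_on_comparison_test[OF sum bound sob_weight_nonneg])
  with assms show ?thesis by (simp add: Hs_def real_valued_def)
qed

lemma sob_weight_has_sum_finite_support: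
  assumes "finite S" "\<And>k. k \<notin> S \<Longrightarrow> c k = 0"
  shows "(sob_weight r c has_sum (\<Sum>k\<in>S. sob_weight r c k)) UNIV"
proof -
  have "(sob_weight r c has_sum (\<Sum>k\<in>S. sob_weight r c k)) S"
    using assms(1) by (rule has_sum_finite)
  then show ?thesis
    by (rule iffD1[OF has_sum_cong_neutral, rotated 3]) (auto simp: sob_weight_def assms(2))
qed

section \<open>The quadratic term\<close>

lemma knorm_nonneg: "0 \<le> knorm k"
  by (simp add: knorm_def)

lemma abs_le_knorm: "\<bar>real_of_int (fst k)\<bar> \<le> knorm k" "\<bar>real_of_int (snd k)\<bar> \<le> knorm k"
  by (auto simp: knorm_def intro!: real_le_rsqrt)

text \<open>The velocity symbol at the advecting mode \<open>j\<close>, paired with the wave vector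
  \<open>k - j\<close> of the gradient; the factor \<i> of the gradient is left out so that the
  value is real.\<close>

definition flux :: "real \<Rightarrow> int \<times> int \<Rightarrow> int \<times> int \<Rightarrow> real" where
  "flux \<beta> k j = fst (vsym \<beta> j) * real_of_int (fst k - fst j)
     + snd (vsym \<beta> j) * real_of_int (snd k - snd j)"

lemma nonlin_eq_flux:
  "nonlin \<beta> c k = (\<Sum>\<^sub>\<infinity>j. \<i> * of_real (flux \<beta> k j) * c j * c (fst k - fst j, snd k - snd j))"
  by (simp add: nonlin_def flux_def)

text \<open>Modes constant in the first variable carry no velocity. This makes the shear steady and
  removes from the linearisation every term in which the shear advects.\<close>

lemma flux_zero: "fst j = 0 \<Longrightarrow> flux \<beta> k j = 0"
  by (simp add: flux_def vsym_def)

lemma flux_vertical: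
  "flux \<beta> (n, k) (n, j) = - ((real_of_int n)\<^sup>2 * knorm (n, j) powr (\<beta> - 2)) * real_of_int (k - j)"
  by (simp add: flux_def vsym_def Let_def power2_eq_square)

text \<open>The velocity is divergence free, so the derivative may be taken outside the product;
  no derivative then falls on the second factor.\<close>
lemma flux_bound:
  assumes "0 \<le> \<beta>" "\<beta> \<le> r"
  shows "\<bar>flux \<beta> k j\<bar> \<le> (\<bar>real_of_int (fst k)\<bar> + \<bar>real_of_int (snd k)\<bar>) * (1 + (knorm j)\<^sup>2) powr (r / 2)"
proof (cases "j = (0, 0)")
  case True
  then show ?thesis by (simp add: flux_zero)
next
  case False
  define m where "m = knorm j powr (\<beta> - 2)"
  define j1 j2 where "j1 = real_of_int (fst j)" "j2 = real_of_int (snd j)"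
  have pos: "0 < knorm j"
    using False by (cases j) (auto simp: knorm_def sum_power2_gt_zero_iff)
  have j12: "\<bar>j1\<bar> \<le> knorm j" "\<bar>j2\<bar> \<le> knorm j"
    unfolding j1_j2_def by (rule abs_le_knorm)+
  have "m * (knorm j * knorm j) = knorm j powr (\<beta> - 2) * knorm j powr 2"
    using pos by (simp add: m_def power2_eq_square)
  also have "\<dots> = knorm j powr \<beta>"
    by (simp flip: powr_add)
  also have "\<dots> \<le> (1 + (knorm j)\<^sup>2) powr (r / 2)"
  proof -
    have "knorm j powr \<beta> = ((knorm j)\<^sup>2) powr (\<beta> / 2)"
      using pos by (simp add: powr_powr flip: powr_numeral)
    also have "\<dots> \<le> (1 + (knorm j)\<^sup>2) powr (\<beta> / 2)"
      using assms by (intro powr_mono2) auto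
    also have "\<dots> \<le> (1 + (knorm j)\<^sup>2) powr (r / 2)"
      using assms by (intro powr_mono) auto
    finally show ?thesis .
  qed
  finally have m: "m * (knorm j * knorm j) \<le> (1 + (knorm j)\<^sup>2) powr (r / 2)" .
  have m0: "0 \<le> m" by (simp add: m_def)
  have 1: "\<bar>j1 * j2 * m\<bar> \<le> (1 + (knorm j)\<^sup>2) powr (r / 2)" "\<bar>j1 * j1 * m\<bar> \<le> (1 + (knorm j)\<^sup>2) powr (r / 2)"
    using mult_mono[OF j12(1) j12(2)] mult_mono[OF j12(1) j12(1)] m0 knorm_nonneg[of j]
    by (auto intro!: order_trans[OF _ m] mult_left_mono simp: abs_mult mult.commute)
  \<comment> \<open>This is where incompressibility enters: the contributions of \<open>- j\<close>
    in \<open>k - j\<close> cancel, leaving only the components of the output mode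
    \<open>k\<close>.\<close>
  have "flux \<beta> k j = j1 * j2 * m * real_of_int (fst k) - j1 * j1 * m * real_of_int (snd k)"
    by (simp add: flux_def vsym_def Let_def m_def j1_j2_def algebra_simps)
  also have "\<bar>\<dots>\<bar> \<le> \<bar>j1 * j2 * m\<bar> * \<bar>real_of_int (fst k)\<bar> + \<bar>j1 * j1 * m\<bar> * \<bar>real_of_int (snd k)\<bar>"
    unfolding abs_mult[symmetric] by (rule abs_triangle_ineq4)
  also have "\<dots> \<le> (1 + (knorm j)\<^sup>2) powr (r / 2) * \<bar>real_of_int (fst k)\<bar> + (1 + (knorm j)\<^sup>2) powr (r / 2) * \<bar>real_of_int (snd k)\<bar>"
    using 1 by (intro add_mono mult_right_mono) auto
  finally show ?thesis by (simp add: algebra_simps)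
qed

text \<open>By \<open>flux_bound\<close> the whole weight of order \<open>r / 2\<close> falls on the
  advecting factor. The inequality \<open>2 * x * y \<le> x^2 + y^2\<close> then dominates each term
  by two Sobolev weights, one of them at the reflected index \<open>k - j\<close>, and both sum to
  the squared norm.\<close>

lemma nonlin_summable_and_bound:
  assumes "0 \<le> \<beta>" "\<beta> \<le> r" "c \<in> Hs r"
  shows "(\<lambda>j. \<i> * of_real (flux \<beta> k j) * c j * c (fst k - fst j, snd k - snd j)) summable_on UNIV" (is "?F summable_on _")
    and "cmod (nonlin \<beta> c k) \<le> (\<bar>real_of_int (fst k)\<bar> + \<bar>real_of_int (snd k)\<bar>) * (hnorm r c)\<^sup>2"
proof -
  define C where "C = \<bar>real_of_int (fst k)\<bar> + \<bar>real_of_int (snd k)\<bar>"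
  define \<phi> where "\<phi> = (\<lambda>j :: int \<times> int. (fst k - fst j, snd k - snd j))"
  \<comment> \<open>The reflection is its own inverse.\<close>
  have bij: "bij \<phi>"
    by (rule o_bij[of \<phi>]) (auto simp: \<phi>_def)
  have sw: "sob_weight r c summable_on UNIV" using assms by (simp add: Hs_def)
  have sw': "(\<lambda>j. sob_weight r c (\<phi> j)) summable_on UNIV"
    using sw summable_on_reindex_bij_betw[OF bij, of "sob_weight r c"] by simp
  have inf': "(\<Sum>\<^sub>\<infinity>j. sob_weight r c (\<phi> j)) = (hnorm r c)\<^sup>2"
    using infsum_reindex_bij_betw[OF bij, of "sob_weight r c"] by (simp add: hnorm_square)
  define G where "G = (\<lambda>j. C / 2 * (sob_weight r c j + sob_weight r c (\<phi> j)))"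
  have G: "G summable_on UNIV"
    unfolding G_def by (intro summable_on_cmult_right summable_on_add sw sw')
  have FG: "norm (?F j) \<le> G j" for j
  proof -
    define w where "w = (1 + (knorm j)\<^sup>2) powr (r / 2) * cmod (c j)"
    have w2: "w\<^sup>2 = sob_weight r c j"
      by (simp add: w_def sob_weight_def power_mult_distrib powr_half_square)
    have C0: "0 \<le> C" by (simp add: C_def)
    have "norm (?F j) = \<bar>flux \<beta> k j\<bar> * cmod (c j) * cmod (c (\<phi> j))"
      by (simp add: norm_mult \<phi>_def)
    also have "\<dots> \<le> (C * (1 + (knorm j)\<^sup>2) powr (r / 2)) * cmod (c j) * cmod (c (\<phi> j))"
      unfolding C_def using flux_bound[OF assms(1,2)] by (intro mult_right_mono) auto
    also have "\<dots> = C * (w * cmod (c (\<phi> j)))" by (simp add: w_def)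
    also have "\<dots> \<le> C * ((w\<^sup>2 + (cmod (c (\<phi> j)))\<^sup>2) / 2)"
      using sum_squares_bound[of w "cmod (c (\<phi> j))"] by (intro mult_left_mono C0) simp
    also have "\<dots> \<le> C * ((sob_weight r c j + sob_weight r c (\<phi> j)) / 2)"
      using sob_weight_ge[of r c "\<phi> j"] assms by (intro mult_left_mono C0) (simp add: w2)
    finally show ?thesis by (simp add: G_def)
  qed
  have abs: "(\<lambda>j. norm (?F j)) summable_on UNIV"
    using G FG by (rule summable_on_comparison_test) auto
  then show "?F summable_on UNIV" by (rule abs_summable_summable)
  have "cmod (nonlin \<beta> c k) \<le> (\<Sum>\<^sub>\<infinity>j. norm (?F j))"
    unfolding nonlin_eq_flux by (rule norm_infsum_bound[OF abs])
  also have "\<dots> \<le> (\<Sum>\<^sub>\<infinity>j. G j)" by (rule infsum_mono[OF abs G FG])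
  also have "\<dots> = C * (hnorm r c)\<^sup>2"
    unfolding G_def infsum_cmult_right' infsum_add[OF sw sw'] inf' by (simp add: hnorm_square)
  finally show "cmod (nonlin \<beta> c k) \<le> (\<bar>real_of_int (fst k)\<bar> + \<bar>real_of_int (snd k)\<bar>) * (hnorm r c)\<^sup>2"
    by (simp add: C_def)
qed

section \<open>Perturbations of a shear\<close>

text \<open>The steady state is $2 \sin x_2$; the perturbation is $2 \cos (n x_1)$.\<close>

definition shear :: "int \<times> int \<Rightarrow> complex" where
  "shear k = (if k = (0, 1) then - \<i> else if k = (0, -1) then \<i> else 0)"

definition wave :: "int \<Rightarrow> int \<times> int \<Rightarrow> complex" where
  "wave n k = (if k = (n, 0) \<or> k = (- n, 0) then 1 else 0)"

section \<open>Size of the linearised coefficients\<close>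

text \<open>The modulus of the coefficient in \<open>flux_vertical\<close> for a unit vertical step:
  the strength with which mode \<open>(n, k)\<close> drives its two neighbours.\<close>

definition amp :: "real \<Rightarrow> int \<Rightarrow> int \<Rightarrow> real" where
  "amp \<beta> n k = (real_of_int n)\<^sup>2 * knorm (n, k) powr (\<beta> - 2)"

lemma amp_nonneg: "0 \<le> amp \<beta> n k"
  by (simp add: amp_def)

text \<open>The exponent \<open>\<beta> - 2\<close> is not positive and \<open>knorm (n, k)\<close>
  is at least \<open>n\<close>. Uniformity in \<open>k\<close> makes the linearised system bounded
  for fixed \<open>n\<close>, so its Taylor remainder vanishes.\<close>

lemma amp_le:
  assumes "\<beta> \<le> 2" "1 \<le> n"
  shows "amp \<beta> n k \<le> real_of_int n powr \<beta>"
proof -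
  have "amp \<beta> n k \<le> (real_of_int n)\<^sup>2 * real_of_int n powr (\<beta> - 2)"
    unfolding amp_def using assms abs_le_knorm(1)[of "(n, k)"]
    by (intro mult_left_mono powr_mono2') auto
  also have "\<dots> = real_of_int n powr 2 * real_of_int n powr (\<beta> - 2)"
    using assms by simp
  also have "\<dots> = real_of_int n powr \<beta>"
    by (simp only: flip: powr_add) simp
  finally show ?thesis .
qed

text \<open>For such \<open>k\<close> the frequency is at most \<open>2 * n\<close>, and
  \<open>2 powr (\<beta> - 2)\<close> is at least 1/4. The cases \<open>k = 0\<close> and
  \<open>k = 1\<close> give the growth rate.\<close>

lemma amp_ge:
  assumes "0 \<le> \<beta>" "\<beta> \<le> 2" "1 \<le> n" "\<bar>k\<bar> \<le> n"
  shows "real_of_int n powr \<beta> / 4 \<le> amp \<beta> n k"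
proof -
  have n: "0 < real_of_int n" using assms by simp
  have kn: "\<bar>real_of_int k\<bar> \<le> real_of_int n" using assms by linarith
  have "knorm (n, k) \<le> 2 * real_of_int n"
  proof -
    have "(real_of_int k)\<^sup>2 \<le> (real_of_int n)\<^sup>2"
      using kn n by (simp add: abs_le_square_iff[symmetric])
    then have "(real_of_int n)\<^sup>2 + (real_of_int k)\<^sup>2 \<le> 4 * (real_of_int n)\<^sup>2"
      using zero_le_power2[of "real_of_int n"] by linarith
    then show ?thesis
      unfolding knorm_def using n by (intro real_le_lsqrt) (auto simp: power_mult_distrib)
  qed
  moreover have "0 < knorm (n, k)"
    using n abs_le_knorm(1)[of "(n, k)"] by simp
  ultimately have le: "(2 * real_of_int n) powr (\<beta> - 2) \<le> knorm (n, k) powr (\<beta> - 2)"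
    using assms by (intro powr_mono2') auto
  have "1 / 4 = 2 powr (- 2 :: real)" by (simp add: powr_minus)
  also have "\<dots> \<le> 2 powr (\<beta> - 2)" using assms by (intro powr_mono) auto
  finally have quarter: "1 / 4 \<le> 2 powr (\<beta> - 2)" .
  have "real_of_int n powr \<beta> / 4 = (1 / 4) * (real_of_int n powr 2 * real_of_int n powr (\<beta> - 2))"
    by (simp only: flip: powr_add) simp
  also have "\<dots> \<le> 2 powr (\<beta> - 2) * (real_of_int n powr 2 * real_of_int n powr (\<beta> - 2))"
    using quarter by (intro mult_right_mono) auto
  also have "\<dots> = (real_of_int n)\<^sup>2 * (2 * real_of_int n) powr (\<beta> - 2)"
    using n by (simp add: powr_mult)
  also have "\<dots> \<le> amp \<beta> n k"
    unfolding amp_def by (intro mult_left_mono le) auto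
  finally show ?thesis .
qed

section \<open>Linearisation at the shear\<close>

lemma nonlin_shear: "nonlin \<beta> shear k = 0"
  unfolding nonlin_eq_flux by (rule infsum_0) (auto simp: shear_def flux_zero)

text \<open>Expanding the product leaves \<open>Q\<close>, the perturbation advecting itself, and
  \<open>L\<close>, the perturbation advecting the shear. \<open>L\<close> lives on the two modes
  that differ from \<open>(n, k)\<close> by a mode of the shear.\<close>

lemma nonlin_shear_plus:
  assumes "0 \<le> \<beta>" "\<beta> \<le> r" "c \<in> Hs r"
  shows "nonlin \<beta> (\<lambda>k. shear k + c k) (n, k)
    = nonlin \<beta> c (n, k) - hop (amp \<beta> n) (\<lambda>j. c (n, j)) k"
proof -
  define L where "L = (\<lambda>j. \<i> * of_real (flux \<beta> (n, k) j) * c j * shear (n - fst j, k - snd j))"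
  define Q where "Q = (\<lambda>j. \<i> * of_real (flux \<beta> (n, k) j) * c j * c (n - fst j, k - snd j))"
  have "(L has_sum (\<Sum>j\<in>{(n, k - 1), (n, k + 1)}. L j)) {(n, k - 1), (n, k + 1)}"
    by (rule has_sum_finite) simp
  then have "(L has_sum (\<Sum>j\<in>{(n, k - 1), (n, k + 1)}. L j)) UNIV"
    by (rule iffD1[OF has_sum_cong_neutral, rotated 3]) (auto simp: L_def shear_def)
  \<comment> \<open>The sine phase matters: the opposite signs of \<open>k - j\<close> at the two
    neighbours are compensated by the opposite signs of \<open>shear\<close>, so both terms are real
    multiples with the same sign.\<close>
  moreover have "(\<Sum>j\<in>{(n, k - 1), (n, k + 1)}. L j) = - hop (amp \<beta> n) (\<lambda>j. c (n, j)) k"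
    by (simp add: L_def shear_def hop_def amp_def flux_vertical algebra_simps)
  ultimately have L: "(L has_sum - hop (amp \<beta> n) (\<lambda>j. c (n, j)) k) UNIV" by simp
  have "Q summable_on UNIV"
    using nonlin_summable_and_bound(1)[OF assms, of "(n, k)"] by (simp add: Q_def)
  then have Q: "(Q has_sum nonlin \<beta> c (n, k)) UNIV"
    by (simp add: nonlin_eq_flux Q_def has_sum_infsum)
  have "\<i> * of_real (flux \<beta> (n, k) j) * (shear j + c j) * (shear (n - fst j, k - snd j) + c (n - fst j, k - snd j))
      = Q j + L j" for j
  proof (cases "fst j = 0")
    case True
    then show ?thesis by (simp add: L_def Q_def flux_zero)
  next
    case False
    then have "shear j = 0" by (auto simp: shear_def)
    then show ?thesis by (simp add: L_def Q_def algebra_simps)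
  qed
  then show ?thesis
    using infsumI[OF has_sum_add[OF Q L]] by (simp add: nonlin_eq_flux)
qed

section \<open>Sobolev norms of the initial data\<close>

lemma shear_in_Hs: "shear \<in> Hs r"
proof -
  have "sob_weight r shear summable_on UNIV"
    by (rule has_sum_imp_summable[OF sob_weight_has_sum_finite_support[of "{(0, 1), (0, -1)}"]])
      (auto simp: shear_def)
  moreover have "real_valued shear"
    by (auto simp: real_valued_def shear_def prod_eq_iff)
  ultimately show ?thesis by (simp add: Hs_def)
qed

lemma shear_solution: "sipm_solution \<beta> r T shear (\<lambda>_. shear)"
  unfolding sipm_solution_def
  by (auto simp: shear_in_Hs nonlin_shear)

lemma hnorm_scaled_wave:
  assumes "1 \<le> n" "0 \<le> \<epsilon>"
  shows "hnorm s (\<lambda>k. of_real \<epsilon> * wave n k) = \<epsilon> * (sqrt 2 * (1 + (real_of_int n)\<^sup>2) powr (s / 2))"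
proof -
  have "(sob_weight s (\<lambda>k. of_real \<epsilon> * wave n k) has_sum
      (\<Sum>k\<in>{(n, 0), (- n, 0)}. sob_weight s (\<lambda>k. of_real \<epsilon> * wave n k) k)) UNIV"
    by (rule sob_weight_has_sum_finite_support) (auto simp: wave_def)
  moreover have "(\<Sum>k\<in>{(n, 0), (- n, 0)}. sob_weight s (\<lambda>k. of_real \<epsilon> * wave n k) k)
      = 2 * \<epsilon>\<^sup>2 * (1 + (real_of_int n)\<^sup>2) powr s"
    using assms by (simp add: sob_weight_def wave_def knorm_def)
  ultimately have "(hnorm s (\<lambda>k. of_real \<epsilon> * wave n k))\<^sup>2 = 2 * \<epsilon>\<^sup>2 * (1 + (real_of_int n)\<^sup>2) powr s"
    by (simp add: hnorm_square infsumI)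
  also have "\<dots> = (\<epsilon> * (sqrt 2 * (1 + (real_of_int n)\<^sup>2) powr (s / 2)))\<^sup>2"
    by (simp add: power_mult_distrib powr_half_square)
  finally show ?thesis
    by (rule power2_eq_imp_eq) (use assms in \<open>simp_all add: hnorm_nonneg\<close>)
qed

text \<open>The supports of shear and wave are disjoint, so the squared norms add. The bound depends
  on neither \<open>n\<close> nor \<epsilon>, which later fixes one time and one Lipschitz constant
  for all perturbations.\<close>

lemma perturbed_shear_datum:
  assumes "1 \<le> n" "\<epsilon>\<^sup>2 * (1 + (real_of_int n)\<^sup>2) powr s \<le> 1"
  shows "(\<lambda>k. shear k + of_real \<epsilon> * wave n k) \<in> Hs s" (is "?c \<in> _")
    and "hnorm s (\<lambda>k. shear k + of_real \<epsilon> * wave n k) \<le> sqrt (2 * 2 powr s + 2)"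
proof -
  have sum: "(sob_weight s ?c has_sum (\<Sum>k\<in>{(0, 1), (0, -1), (n, 0), (- n, 0)}. sob_weight s ?c k)) UNIV"
    by (rule sob_weight_has_sum_finite_support) (auto simp: wave_def shear_def)
  moreover have "real_valued ?c"
    by (auto simp: real_valued_def shear_def wave_def prod_eq_iff)
  ultimately show "?c \<in> Hs s"
    by (auto simp: Hs_def dest: has_sum_imp_summable)
  have "(\<Sum>k\<in>{(0, 1), (0, -1), (n, 0), (- n, 0)}. sob_weight s ?c k)
      = 2 * 2 powr s + 2 * (\<epsilon>\<^sup>2 * (1 + (real_of_int n)\<^sup>2) powr s)"
    using assms(1) by (simp add: sob_weight_def wave_def shear_def knorm_def)
  also have "\<dots> \<le> 2 * 2 powr s + 2" using assms(2) by simp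
  finally show "hnorm s ?c \<le> sqrt (2 * 2 powr s + 2)"
    unfolding hnorm_def infsumI[OF sum] by simp
qed

text \<open>The mode (n, .) of the perturbation solves the linearised system up to an error quadratic
  in \<epsilon>, so letting \<epsilon> tend to 0 no limit solution of the linearised equation is needed.\<close>
lemma linear_response_forces_growth:
  assumes \<beta>: "0 \<le> \<beta>" "\<beta> \<le> 2" "\<beta> \<le> r" and n: "1 \<le> n" and "0 \<le> T" "0 \<le> D" "0 < \<eta>"
    and sol: "\<And>\<epsilon>. 0 < \<epsilon> \<Longrightarrow> \<epsilon> \<le> \<eta> \<Longrightarrow> \<exists>\<rho> T'. T \<le> T' \<and>
      sipm_solution \<beta> r T' (\<lambda>k. shear k + of_real \<epsilon> * wave n k) \<rho> \<and>
      (\<forall>t\<in>{0..T}. hnorm r (\<lambda>k. \<rho> t k - shear k) \<le> \<epsilon> * D)"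
  shows "exp (real_of_int n powr \<beta> / 4 * T) \<le> 2 * D"
proof -
  define A where "A = real_of_int n powr \<beta>"
  define \<mu> where "\<mu> = A / 4"
  define c where "c = (\<lambda>k. \<bar>real_of_int n\<bar> + \<bar>real_of_int k\<bar>)"
  define E where "E = (\<lambda>J. taylor_err T A c J 0 + taylor_err T A c J 1)"
  define S where "S = (\<lambda>J. \<Sum>j<J. (\<mu> * T) ^ j / fact j)"
  define R where "R = (\<lambda>J. (2 * A * T) ^ J / fact J)"
  have r: "0 \<le> r" using \<beta> by linarith
  \<comment> \<open>The perturbation is of order \<epsilon> and its forcing of order \<epsilon>^2;
    after division by \<epsilon> only the forcing term still carries a factor \<epsilon>.\<close>
  have step: "S J \<le> 2 * D + \<epsilon> * (D\<^sup>2 * E J) + 2 * D * R J" if \<epsilon>: "0 < \<epsilon>" "\<epsilon> \<le> \<eta>" for \<epsilon> J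
  proof -
    obtain \<rho> T' where T': "T \<le> T'"
      and \<rho>: "sipm_solution \<beta> r T' (\<lambda>k. shear k + of_real \<epsilon> * wave n k) \<rho>"
      and close: "\<And>t. t \<in> {0..T} \<Longrightarrow> hnorm r (\<lambda>k. \<rho> t k - shear k) \<le> \<epsilon> * D"
      using sol[OF \<epsilon>] by blast
    define \<psi> where "\<psi> = (\<lambda>t k. \<rho> t k - shear k)"
    define f where "f = (\<lambda>t k. \<psi> t (n, k))"
    define q where "q = (\<lambda>t k. - nonlin \<beta> (\<psi> t) (n, k))"
    \<comment> \<open>Since \<open>n\<close> and \<open>- n\<close> differ, the wave meets the line
      of modes \<open>(n, k)\<close> only at \<open>k = 0\<close>.\<close>
    define g :: "int \<Rightarrow> real" where "g = (\<lambda>k. if k = 0 then 1 else 0)"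
    have \<psi>_Hs: "\<psi> t \<in> Hs r" if "t \<in> {0..T}" for t
      unfolding \<psi>_def using \<rho> that T' by (intro Hs_diff shear_in_Hs) (auto simp: sipm_solution_def)
    have \<psi>_norm: "hnorm r (\<psi> t) \<le> \<epsilon> * D" if "t \<in> {0..T}" for t
      using close[OF that] by (simp add: \<psi>_def)
    have f0: "f 0 = (\<lambda>k. of_real (\<epsilon> * g k))"
      using \<rho> n by (auto simp: f_def \<psi>_def g_def sipm_solution_def wave_def)
    have taylor: "cmod (f T k - (\<Sum>j<J. of_real (T ^ j / fact j) * (hop (amp \<beta> n) ^^ j) (f 0) k))
        \<le> (\<epsilon> * D)\<^sup>2 * taylor_err T A c J k + (\<epsilon> * D) * (2 * A) ^ J * (T ^ J / fact J)" for k
    proof (rule tridiagonal_taylor_bound)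
      show "amp \<beta> n k \<le> A" for k unfolding A_def by (rule amp_le[OF \<beta>(2) n])
      show "cmod (f t k) \<le> \<epsilon> * D" if "t \<in> {0..T}" for t k
        using cmod_le_hnorm[OF r \<psi>_Hs[OF that], of "(n, k)"] \<psi>_norm[OF that] by (simp add: f_def)
      show "((\<lambda>\<tau>. hop (amp \<beta> n) (f \<tau>) k + q \<tau> k) has_integral f t k - f 0 k) {0..t}"
        if t: "t \<in> {0..T}" for t k
      proof -
        \<comment> \<open>The integral in \<open>sipm_solution\<close> equals datum minus solution;
          the change of sign makes the coefficients of \<open>hop\<close> positive.\<close>
        have "((\<lambda>\<tau>. nonlin \<beta> (\<rho> \<tau>) (n, k)) has_integral (\<rho> 0 (n, k) - \<rho> t (n, k))) {0..t}"
          using \<rho> t T' by (simp add: sipm_solution_def)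
        from has_integral_neg[OF this]
        have "((\<lambda>\<tau>. - nonlin \<beta> (\<rho> \<tau>) (n, k)) has_integral (f t k - f 0 k)) {0..t}"
          by (simp add: f_def \<psi>_def)
        moreover have "- nonlin \<beta> (\<rho> \<tau>) (n, k) = hop (amp \<beta> n) (f \<tau>) k + q \<tau> k"
          if "\<tau> \<in> {0..t}" for \<tau>
        proof -
          have "\<tau> \<in> {0..T}" using that t by auto
          from nonlin_shear_plus[OF \<beta>(1,3) \<psi>_Hs[OF this], of n k]
          show ?thesis by (simp add: \<psi>_def f_def q_def)
        qed
        ultimately show ?thesis by (rule has_integral_eq[rotated])
      qed
      show "cmod (q t k) \<le> (\<epsilon> * D)\<^sup>2 * c k" if "t \<in> {0..T}" for t k
      proof -
        have "cmod (q t k) \<le> c k * (hnorm r (\<psi> t))\<^sup>2"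
          using nonlin_summable_and_bound(2)[OF \<beta>(1,3) \<psi>_Hs[OF that], of "(n, k)"]
          by (simp add: q_def c_def)
        also have "\<dots> \<le> c k * (\<epsilon> * D)\<^sup>2"
          using \<psi>_norm[OF that] hnorm_nonneg by (intro mult_left_mono power_mono) (auto simp: c_def)
        finally show ?thesis by (simp add: mult.commute)
      qed
    qed (use \<epsilon> \<open>0 \<le> T\<close> \<open>0 \<le> D\<close> in \<open>auto simp: amp_nonneg c_def\<close>)
    define P where "P = (\<lambda>k. \<Sum>j<J. of_real (T ^ j / fact j) * (hop (amp \<beta> n) ^^ j) (f 0) k)"
    have "\<epsilon> * S J \<le> Re (P 0 + P 1)"
    proof -
      have "\<epsilon> * S J = (\<Sum>j<J. \<epsilon> * (T ^ j / fact j) * \<mu> ^ j)"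
        by (simp add: S_def sum_distrib_left power_mult_distrib mult_ac)
      also have "\<dots> \<le> (\<Sum>j<J. \<epsilon> * (T ^ j / fact j) *
          Re ((hop (amp \<beta> n) ^^ j) (\<lambda>k. of_real (g k)) 0 + (hop (amp \<beta> n) ^^ j) (\<lambda>k. of_real (g k)) 1))"
        using \<epsilon> n \<open>0 \<le> T\<close> amp_ge[OF \<beta>(1,2) n, of 0] amp_ge[OF \<beta>(1,2) n, of 1]
        by (intro sum_mono mult_left_mono hop_funpow_lower_bound)
          (auto simp: amp_nonneg g_def \<mu>_def A_def)
      also have "\<dots> = Re (P 0 + P 1)"
      proof -
        have "Re (of_real x * (of_real \<epsilon> * z)) = \<epsilon> * x * Re z" for x z
          by simp
        then show ?thesis
          unfolding P_def f0 hop_funpow_scale plus_complex.sel Re_sum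
          by (simp only: distrib_left sum.distrib)
      qed
      finally show ?thesis .
    qed
    also have "\<dots> \<le> cmod (P 0 + P 1)" by (rule complex_Re_le_cmod)
    also have "\<dots> \<le> cmod (f T 0) + cmod (f T 1) + cmod (f T 0 - P 0) + cmod (f T 1 - P 1)"
      using norm_triangle_ineq[of "P 0" "P 1"] norm_triangle_sub[of "P 0" "f T 0"]
        norm_triangle_sub[of "P 1" "f T 1"] by (simp add: norm_minus_commute)
    also have "\<dots> \<le> \<epsilon> * D + \<epsilon> * D + ((\<epsilon> * D)\<^sup>2 * taylor_err T A c J 0 + (\<epsilon> * D) * (2 * A) ^ J * (T ^ J / fact J))
        + ((\<epsilon> * D)\<^sup>2 * taylor_err T A c J 1 + (\<epsilon> * D) * (2 * A) ^ J * (T ^ J / fact J))"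
    proof (intro add_mono)
      have T: "T \<in> {0..T}" using \<open>0 \<le> T\<close> by simp
      show "cmod (f T k) \<le> \<epsilon> * D" for k
        using cmod_le_hnorm[OF r \<psi>_Hs[OF T], of "(n, k)"] \<psi>_norm[OF T] by (simp add: f_def)
      then show "cmod (f T 1) \<le> \<epsilon> * D" .
    qed (use taylor in \<open>simp_all only: P_def\<close>)
    also have "\<dots> = \<epsilon> * (2 * D + \<epsilon> * (D\<^sup>2 * E J) + 2 * D * R J)"
      by (simp add: E_def R_def power2_eq_square power_mult_distrib algebra_simps)
    finally show ?thesis using \<epsilon> by simp
  qed
  \<comment> \<open>The order of limits matters: \<epsilon> tends to 0 with \<open>J\<close> fixed,
    which removes \<open>E J\<close> without any control of its growth in \<open>J\<close>; only
    then does \<open>J\<close> tend to infinity.\<close>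
  have SJ: "S J \<le> 2 * D + 2 * D * R J" for J
  proof (rule tendsto_lowerbound)
    show "((\<lambda>\<epsilon>. 2 * D + \<epsilon> * (D\<^sup>2 * E J) + 2 * D * R J) \<longlongrightarrow> 2 * D + 2 * D * R J) (at_right 0)"
      by (auto intro!: tendsto_eq_intros)
    show "\<forall>\<^sub>F \<epsilon> in at_right 0. S J \<le> 2 * D + \<epsilon> * (D\<^sup>2 * E J) + 2 * D * R J"
      using eventually_at_right_less[of 0] eventually_at_right_real[OF \<open>0 < \<eta>\<close>]
      by eventually_elim (use step in auto)
  qed simp
  have "S \<longlonglongrightarrow> exp (\<mu> * T)"
    using exp_converges[of "\<mu> * T"] by (simp add: S_def sums_def divide_inverse mult.commute)
  moreover have "R \<longlonglongrightarrow> 0"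
    using summable_LIMSEQ_zero[OF summable_exp[of "2 * A * T"]] by (simp add: R_def divide_inverse mult.commute)
  then have "(\<lambda>J. 2 * D + 2 * D * R J) \<longlonglongrightarrow> 2 * D"
    by (auto intro!: tendsto_eq_intros)
  ultimately have "exp (\<mu> * T) \<le> 2 * D"
    using SJ by (intro LIMSEQ_le) auto
  then show ?thesis by (simp add: \<mu>_def A_def)
qed

section \<open>Exponential against polynomial growth in the frequency\<close>

theorem theorem2p4:
  fixes \<beta> r s :: real
  assumes "0 < \<beta>" and "\<beta> < 2" and "r > 2" and "s \<ge> r + 1"
  shows "\<not> locally_lipschitz_wellposed \<beta> r s"
proof
  assume "locally_lipschitz_wellposed \<beta> r s"
  then obtain T K :: "real \<Rightarrow> real \<Rightarrow> real" where
    T_pos: "\<forall>a\<ge>0. \<forall>b\<ge>0. T a b > 0"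
    and T_mono: "\<forall>a a' b b'. 0 \<le> a \<longrightarrow> a \<le> a' \<longrightarrow> 0 \<le> b \<longrightarrow> b \<le> b' \<longrightarrow> T a' b' \<le> T a b"
    and K_pos: "\<forall>a\<ge>0. \<forall>b\<ge>0. K a b > 0"
    and K_mono: "\<forall>a a' b b'. 0 \<le> a \<longrightarrow> a \<le> a' \<longrightarrow> 0 \<le> b \<longrightarrow> b \<le> b' \<longrightarrow> K a b \<le> K a' b'"
    and wp: "\<forall>c1\<in>Hs s. \<forall>c2\<in>Hs s.
       \<exists>\<rho>1 \<rho>2. sipm_solution \<beta> r (T (hnorm s c1) (hnorm s c2)) c1 \<rho>1 \<and>
         sipm_solution \<beta> r (T (hnorm s c1) (hnorm s c2)) c2 \<rho>2 \<and>
         (\<forall>\<sigma>. sipm_solution \<beta> r (T (hnorm s c1) (hnorm s c2)) c1 \<sigma> \<longrightarrow>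
            (\<forall>t\<in>{0..T (hnorm s c1) (hnorm s c2)}. \<sigma> t = \<rho>1 t)) \<and>
         (\<forall>\<sigma>. sipm_solution \<beta> r (T (hnorm s c1) (hnorm s c2)) c2 \<sigma> \<longrightarrow>
            (\<forall>t\<in>{0..T (hnorm s c1) (hnorm s c2)}. \<sigma> t = \<rho>2 t)) \<and>
         (\<forall>t\<in>{0..T (hnorm s c1) (hnorm s c2)}.
            hnorm r (\<lambda>k. \<rho>1 t k - \<rho>2 t k) \<le> K (hnorm s c1) (hnorm s c2) * hnorm s (\<lambda>k. c1 k - c2 k))"
    unfolding locally_lipschitz_wellposed_def Let_def by (elim exE conjE) (rule that)
  define h0 where "h0 = hnorm s shear"
  define h1 where "h1 = sqrt (2 * 2 powr s + 2)"
  define T0 where "T0 = T h0 h1"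
  define K0 where "K0 = K h0 h1"
  have h: "0 \<le> h0" "0 \<le> h1" by (auto simp: h0_def h1_def hnorm_nonneg)
  have T0: "0 < T0" and K0: "0 < K0"
    unfolding T0_def K0_def using T_pos K_pos h by auto
  have growth: "exp (real n powr \<beta> / 4 * T0) \<le> 2 * (K0 * (sqrt 2 * (1 + (real n)\<^sup>2) powr (s / 2)))"
    if n: "1 \<le> n" for n :: nat
  proof -
    define D where "D = K0 * (sqrt 2 * (1 + (real n)\<^sup>2) powr (s / 2))"
    \<comment> \<open>With this threshold \<open>\<epsilon>^2 * (1 + n^2) powr s\<close> is at most
      1, as \<open>perturbed_shear_datum\<close> requires.\<close>
    define \<eta> where "\<eta> = (1 + (real n)\<^sup>2) powr (- s / 2)"
    have "exp (real_of_int (int n) powr \<beta> / 4 * T0) \<le> 2 * D"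
    proof (rule linear_response_forces_growth[where r = r and \<eta> = \<eta>])
      have "0 < 1 + (real n)\<^sup>2" by (intro add_pos_nonneg) auto
      then show "0 < \<eta>" by (simp add: \<eta>_def)
    next
      fix \<epsilon> :: real
      assume \<epsilon>: "0 < \<epsilon>" "\<epsilon> \<le> \<eta>"
      define c where "c = (\<lambda>k. shear k + of_real \<epsilon> * wave (int n) k)"
      have "\<epsilon>\<^sup>2 * (1 + (real n)\<^sup>2) powr s \<le> \<eta>\<^sup>2 * (1 + (real n)\<^sup>2) powr s"
        using \<epsilon> by (intro mult_right_mono power_mono) auto
      also have "\<eta>\<^sup>2 = (1 + (real n)\<^sup>2) powr (- s)"
        unfolding \<eta>_def by (rule powr_half_square)
      also have "\<dots> * (1 + (real n)\<^sup>2) powr s = (1 + (real n)\<^sup>2) powr 0"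
        by (simp flip: powr_add)
      also have "\<dots> \<le> 1" by simp
      finally have small: "\<epsilon>\<^sup>2 * (1 + (real_of_int (int n))\<^sup>2) powr s \<le> 1" by simp
      have c: "c \<in> Hs s" "hnorm s c \<le> h1"
        using perturbed_shear_datum[OF _ small] n by (auto simp: c_def h1_def)
      \<comment> \<open>Monotonicity replaces the norm of the perturbed datum by its uniform bound
        \<open>h1\<close>, so \<open>T0\<close> and \<open>K0\<close> do not depend on
        \<open>n\<close> or \<epsilon>.\<close>
      have T: "T0 \<le> T h0 (hnorm s c)"
        unfolding T0_def using c h by (intro T_mono[rule_format]) (auto simp: hnorm_nonneg)
      have K: "K h0 (hnorm s c) \<le> K0"
        unfolding K0_def using c h by (intro K_mono[rule_format]) (auto simp: hnorm_nonneg)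
      obtain \<rho>1 \<rho>2 where \<rho>2: "sipm_solution \<beta> r (T h0 (hnorm s c)) c \<rho>2"
        and uniq: "\<forall>\<sigma>. sipm_solution \<beta> r (T h0 (hnorm s c)) shear \<sigma> \<longrightarrow>
            (\<forall>t\<in>{0..T h0 (hnorm s c)}. \<sigma> t = \<rho>1 t)"
        and lip: "\<forall>t\<in>{0..T h0 (hnorm s c)}.
            hnorm r (\<lambda>k. \<rho>1 t k - \<rho>2 t k) \<le> K h0 (hnorm s c) * hnorm s (\<lambda>k. shear k - c k)"
        using wp[THEN bspec, OF shear_in_Hs, THEN bspec, OF c(1), folded h0_def]
        by (elim exE conjE) (rule that)
      have "hnorm r (\<lambda>k. \<rho>2 t k - shear k) \<le> \<epsilon> * D" if "t \<in> {0..T0}" for t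
      proof -
        have t: "t \<in> {0..T h0 (hnorm s c)}" using that T by auto
        \<comment> \<open>Uniqueness identifies \<open>\<rho>1\<close> with the steady
          shear.\<close>
        have "hnorm r (\<lambda>k. \<rho>2 t k - shear k) = hnorm r (\<lambda>k. \<rho>1 t k - \<rho>2 t k)"
          using uniq[rule_format, OF shear_solution t] hnorm_minus_commute[of r shear "\<rho>2 t"] by simp
        also have "\<dots> \<le> K h0 (hnorm s c) * hnorm s (\<lambda>k. c k - shear k)"
          using lip[rule_format, OF t] hnorm_minus_commute[of s shear c] by simp
        also have "\<dots> \<le> K0 * hnorm s (\<lambda>k. c k - shear k)"
          by (intro mult_right_mono K hnorm_nonneg)
        also have "\<dots> = \<epsilon> * D"
          using hnorm_scaled_wave[of "int n" \<epsilon> s] n \<epsilon> by (simp add: c_def D_def)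
        finally show ?thesis .
      qed
      with T \<rho>2[unfolded c_def] show "\<exists>\<rho> T'. T0 \<le> T' \<and>
          sipm_solution \<beta> r T' (\<lambda>k. shear k + of_real \<epsilon> * wave (int n) k) \<rho> \<and>
          (\<forall>t\<in>{0..T0}. hnorm r (\<lambda>k. \<rho> t k - shear k) \<le> \<epsilon> * D)"
        by (intro exI[of _ \<rho>2] exI[of _ "T h0 (hnorm s c)"]) (simp add: c_def)
    qed (use assms n T0 K0 in \<open>auto simp: D_def\<close>)
    then show ?thesis by (simp add: D_def)
  qed
  \<comment> \<open>For fixed positive \<open>T0\<close> and \<beta> the exponential of
    \<open>n powr \<beta>\<close> outgrows every power of \<open>n\<close>, whatever the value of
    \<open>s\<close>.\<close>
  have "\<forall>\<^sub>F n :: nat in sequentially.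
      2 * (K0 * (sqrt 2 * (1 + (real n)\<^sup>2) powr (s / 2))) < exp (real n powr \<beta> / 4 * T0)"
    using T0 K0 \<open>0 < \<beta>\<close> by real_asymp
  with eventually_ge_at_top[of 1] have "\<forall>\<^sub>F n :: nat in sequentially. False"
    by eventually_elim (use growth in force)
  then show False by simp
qed

end
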